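(* Let $K$ be a Rayner field. Then $K$ satisfies the canonical second lifting property.
   Context: Let $k$ be a field and $(G,+,<)$ a non-trivial totally ordered abelian group. $\mathbb K=k((G))$ is the field of all formal series $a=\sum_{g\in G}a_gt^g$ ($a_g\in k$) whose support $\operatorname{supp}a=\{g:a_g\neq 0\}$ is well ordered, with termwise addition and convolution product. $k(G)\subseteq\mathbb K$ is the fraction field of the group ring $k[G]$. A Hahn field is a field $K$ with $k(G)\subseteq K\subseteq\mathbb K$; it carries the valuation $v(a)=\min\operatorname{supp}a$ ($a\ne0$), $v(0)=\infty$. A family $\mathcal F\neq\emptyset$ of subsets of $G$ is a field family (with respect to $G$) if: (R1) the elements of $\mathcal F$ are well ordered subsets of $G$; (R2) the union of the elements of $\mathcal F$ generates $G$ as a group; (R3) $A,B\in\mathcal F\Rightarrow A\cup B\in\mathcal F$; (R4) $A\in\mathcal F,\ B\subset A\Rightarrow B\in\mathcal F$; (R5) $A\in\mathcal F,\ g\in G\Rightarrow A+g\in\mathcal F$; (R6) if $A\in\mathcal F$ and $A\subseteq G^{\ge0}$, then the set of all finite sums of elements of $A$ belongs to $\mathcal F$. For a field family $\mathcal F$, the set $k((\mathcal F))=\{a\in\mathbb K:\operatorname{supp}a\in\mathcal F\}$ is a subfield of $\mathbb K$ (known theorem of Rayner) and is a Hahn field; such fields are called Rayner fields. $v\text{-}\mathrm{Aut}\,K$ is the group of field automorphisms $\sigma$ of $K$ for which there is an order preserving automorphism $\sigma_G$ of $G$ with $\sigma_G(v(a))=v(\sigma(a))$ for all $a\in K^\times$.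 Such $\sigma$ induces $\sigma_k\in\mathrm{Aut}\,k$, $\sigma_k(c)=\sigma(c)_0$ (constant term) for $c\in k$. The group $\mathrm{IntAut}\,K$ of internal automorphisms consists of the $\sigma\in v\text{-}\mathrm{Aut}\,K$ with $\sigma_G=\mathrm{id}_G$ and $\sigma_k=\mathrm{id}_k$. $\mathrm{Hom}(G,k^\times)$ is the group, under pointwise multiplication, of homomorphisms $x\colon(G,+)\to(k^\times,\cdot)$, with $x^g:=x(g)$. $K$ has the canonical second lifting property if $x\mapsto\rho_x$, $\rho_x(\sum a_gt^g)=\sum a_gx^gt^g$, is a well defined group homomorphism $\mathrm{Hom}(G,k^\times)\to\mathrm{IntAut}\,K$. *)

theory Defs
  imports "HOL-Algebra.Algebra"
begin

text \<open>
  The ordered group \<open>G\<close> is a type \<open>'g :: linordered_ab_group_add\<close> and the coefficient field a type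
  \<open>'k :: field\<close>. A formal series is its coefficient function \<open>'g \<Rightarrow> 'k\<close>; such functions are only
  meaningful as series when they lie in the carrier of \<open>hahn_ring\<close> below.
\<close>

definition well_ordered :: "'g::linorder set \<Rightarrow> bool" where
  "well_ordered A \<longleftrightarrow> well_order_on A {(x, y). x \<in> A \<and> y \<in> A \<and> x \<le> y}"

definition supp :: "('g \<Rightarrow> 'k::zero) \<Rightarrow> 'g set" where
  "supp a = {g. a g \<noteq> 0}"

text \<open>
  The index set of the convolution sum is finite whenever both supports are well ordered.
\<close>

definition hahn_mult ::
  "('g::linordered_ab_group_add \<Rightarrow> 'k::field) \<Rightarrow> ('g \<Rightarrow> 'k) \<Rightarrow> 'g \<Rightarrow> 'k" where
  "hahn_mult a b = (\<lambda>g. \<Sum>h | h \<in> supp a \<and> g - h \<in> supp b. a h * b (g - h))"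

definition const :: "'k::zero \<Rightarrow> 'g::zero \<Rightarrow> 'k" where
  "const c = (\<lambda>g. if g = 0 then c else 0)"

definition hahn_ring :: "('g::linordered_ab_group_add \<Rightarrow> 'k::field) ring" where
  "hahn_ring = \<lparr>carrier = {a. well_ordered (supp a)}, monoid.mult = hahn_mult, one = const 1,
     ring.zero = (\<lambda>_. 0), add = (\<lambda>a b g. a g + b g)\<rparr>"

text \<open>The valuation \<open>v\<close>, used for nonzero series only, so that no value \<open>\<infinity>\<close> is needed.\<close>

definition val :: "('g::linorder \<Rightarrow> 'k::zero) \<Rightarrow> 'g" where
  "val a = (LEAST g. g \<in> supp a)"

definition add_group :: "'g::ab_group_add monoid" where
  "add_group = \<lparr>carrier = UNIV, monoid.mult = (+), one = 0\<rparr>"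

text \<open>
  In the last condition the empty list contributes the empty sum \<open>0\<close>. For a non-trivial group this is
  immaterial: the remaining conditions put \<open>{0}\<close> into the family and make it closed under adding
  or removing the element \<open>0\<close>.
\<close>

definition field_family :: "'g::linordered_ab_group_add set set \<Rightarrow> bool" where
  "field_family \<F> \<longleftrightarrow>
     \<F> \<noteq> {} \<and>
     (\<forall>A\<in>\<F>. well_ordered A) \<and>
     generate add_group (\<Union>\<F>) = UNIV \<and>
     (\<forall>A\<in>\<F>. \<forall>B\<in>\<F>. A \<union> B \<in> \<F>) \<and>
     (\<forall>A\<in>\<F>. \<forall>B. B \<subseteq> A \<longrightarrow> B \<in> \<F>) \<and>
     (\<forall>A\<in>\<F>. \<forall>g. (\<lambda>a. a + g) ` A \<in> \<F>) \<and>
     (\<forall>A\<in>\<F>. A \<subseteq> {0..} \<longrightarrow> {sum_list xs | xs. set xs \<subseteq> A} \<in> \<F>)"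

definition rayner_set ::
  "'g::linordered_ab_group_add set set \<Rightarrow> ('g \<Rightarrow> 'k::field) set" where
  "rayner_set \<F> = {a \<in> carrier hahn_ring. supp a \<in> \<F>}"

text \<open>
  That such a set is a subfield of the field of all series is a theorem of Rayner and hence not part
  of the definition.
\<close>

definition rayner_field :: "('g::linordered_ab_group_add \<Rightarrow> 'k::field) set \<Rightarrow> bool" where
  "rayner_field K \<longleftrightarrow> (\<exists>\<F>. field_family \<F> \<and> K = rayner_set \<F>)"

text \<open>
  Automorphisms of \<open>K\<close> are taken to be extensional (\<open>undefined\<close> outside \<open>K\<close>), as in \<^const>\<open>BijGroup\<close>,
  so that equality of automorphisms is equality on \<open>K\<close>.
\<close>

definition field_aut ::
  "('g::linordered_ab_group_add \<Rightarrow> 'k::field) set \<Rightarrow> (('g \<Rightarrow> 'k) \<Rightarrow> ('g \<Rightarrow> 'k)) set" where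
  "field_aut K = ring_iso (hahn_ring\<lparr>carrier := K\<rparr>) (hahn_ring\<lparr>carrier := K\<rparr>) \<inter> extensional K"

definition induces ::
  "('g::linordered_ab_group_add \<Rightarrow> 'k::field) set \<Rightarrow> (('g \<Rightarrow> 'k) \<Rightarrow> ('g \<Rightarrow> 'k)) \<Rightarrow> ('g \<Rightarrow> 'g) \<Rightarrow> bool"
  where
  "induces K \<sigma> \<tau> \<longleftrightarrow>
     \<tau> \<in> iso add_group add_group \<and> mono \<tau> \<and>
     (\<forall>a\<in>K - {\<zero>\<^bsub>hahn_ring\<^esub>}. \<tau> (val a) = val (\<sigma> a))"

definition v_aut ::
  "('g::linordered_ab_group_add \<Rightarrow> 'k::field) set \<Rightarrow> (('g \<Rightarrow> 'k) \<Rightarrow> ('g \<Rightarrow> 'k)) set" where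
  "v_aut K = {\<sigma> \<in> field_aut K. \<exists>\<tau>. induces K \<sigma> \<tau>}"

text \<open>
  The induced automorphism of \<open>G\<close> is unique as soon as \<open>K\<close> contains all monomials, because
  \<open>v\<close> is then onto \<open>G\<close>; in particular for all Hahn fields.
\<close>

definition induced_G ::
  "('g::linordered_ab_group_add \<Rightarrow> 'k::field) set \<Rightarrow> (('g \<Rightarrow> 'k) \<Rightarrow> ('g \<Rightarrow> 'k)) \<Rightarrow> 'g \<Rightarrow> 'g" where
  "induced_G K \<sigma> = (THE \<tau>. induces K \<sigma> \<tau>)"

definition induced_k ::
  "(('g::linordered_ab_group_add \<Rightarrow> 'k::field) \<Rightarrow> ('g \<Rightarrow> 'k)) \<Rightarrow> 'k \<Rightarrow> 'k" where
  "induced_k \<sigma> = (\<lambda>c. \<sigma> (const c) 0)"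

definition IntAut ::
  "('g::linordered_ab_group_add \<Rightarrow> 'k::field) set \<Rightarrow> (('g \<Rightarrow> 'k) \<Rightarrow> ('g \<Rightarrow> 'k)) monoid" where
  "IntAut K = (BijGroup K)
     \<lparr>carrier := {\<sigma> \<in> v_aut K. induced_G K \<sigma> = id \<and> induced_k \<sigma> = id}\<rparr>"

definition units_group :: "'k::field monoid" where
  "units_group = \<lparr>carrier = - {0}, monoid.mult = (*), one = 1\<rparr>"

definition char_group :: "('g::linordered_ab_group_add \<Rightarrow> 'k::field) monoid" where
  "char_group = \<lparr>carrier = hom add_group units_group, monoid.mult = (\<lambda>x y g. x g * y g), one = (\<lambda>_. 1)\<rparr>"

definition rho ::
  "('g \<Rightarrow> 'k::field) set \<Rightarrow> ('g \<Rightarrow> 'k) \<Rightarrow> ('g \<Rightarrow> 'k) \<Rightarrow> 'g \<Rightarrow> 'k" where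
  "rho K x = (\<lambda>a\<in>K. \<lambda>g. a g * x g)"

definition canonical_second_lifting ::
  "('g::linordered_ab_group_add \<Rightarrow> 'k::field) set \<Rightarrow> bool" where
  "canonical_second_lifting K \<longleftrightarrow> group_hom char_group (IntAut K) (rho K)"

end

theory Submission
  imports Defs
begin

text \<open>
  For a character \<open>x\<close>, multiplying the coefficient at \<open>g\<close> by \<open>x g \<noteq> 0\<close> leaves the support of a
  series unchanged. Membership in a Rayner field depends on the support alone, so \<open>\<rho>\<^sub>x\<close> maps the
  field bijectively to itself, with inverse \<open>\<rho>\<close> of the pointwise inverse of \<open>x\<close>; it preserves the
  valuation for the same reason, and it fixes constants because \<open>x 0 = 1\<close>. It respects convolution
  because \<open>x g = x h * x (g - h)\<close> can be distributed over the sum for the coefficient at \<open>g\<close>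
  (lemma \<open>rho_internal\<close>). That \<open>\<rho>\<close> turns products of characters into compositions is then clear.

  What takes more work is that the internal automorphisms form a group. The one delicate
  condition is that the induced map on \<open>k\<close> be the identity: an internal automorphism may send a
  constant \<open>c\<close> to \<open>c + r\<close> with \<open>v r > 0\<close>, so constants are not fixed and the condition does not
  compose by itself. The remedy is lemma \<open>internal_residue\<close>: since an internal automorphism is
  additive and preserves \<open>v\<close>, it preserves the constant term of every series of valuation
  \<open>\<ge> 0\<close>. This argument works in any ring of series that contains all monomials
  (locale \<open>monomial_subring\<close>). Rayner fields are such rings: the support of a product lies in the
  set of sums of two exponents, which up to translation is covered by the closure of the family
  under finite sums (lemma \<open>field_family_sumset\<close>).
\<close>

section \<open>Well-ordered supports and the valuation\<close>

lemma well_ordered_has_least: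
  assumes "well_ordered A" "A \<noteq> {}"
  obtains m where "m \<in> A" "\<And>x. x \<in> A \<Longrightarrow> m \<le> x"
proof -
  let ?r = "{(x, y). x \<in> A \<and> y \<in> A \<and> x \<le> y}"
  have "wf (?r - Id)"
    using assms(1) unfolding well_ordered_def well_order_on_def by blast
  moreover obtain q where "q \<in> A" using assms(2) by blast
  ultimately obtain m where m: "m \<in> A" "\<And>y. (y, m) \<in> ?r - Id \<Longrightarrow> y \<notin> A"
    using wfE_min[of "?r - Id" q A] by blast
  have "m \<le> x" if "x \<in> A" for x
    using m(1) m(2)[of x] that by force
  with m(1) show ?thesis by (rule that)
qed

lemma val_properties:
  assumes "well_ordered (supp a)" "a \<noteq> (\<lambda>_. 0)"
  shows val_in_supp: "a (val a) \<noteq> 0"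
    and val_le: "a g \<noteq> 0 \<Longrightarrow> val a \<le> g"
proof -
  have "supp a \<noteq> {}" using assms(2) by (auto simp: supp_def fun_eq_iff)
  then obtain m where m: "m \<in> supp a" "\<And>x. x \<in> supp a \<Longrightarrow> m \<le> x"
    using well_ordered_has_least assms(1) by blast
  have "val a = m" unfolding val_def by (rule Least_equality) (use m in auto)
  then show "a (val a) \<noteq> 0" "a g \<noteq> 0 \<Longrightarrow> val a \<le> g"
    using m by (auto simp: supp_def)
qed

lemma val_monomial:
  assumes "c \<noteq> 0"
  shows "val (\<lambda>h. if h = g then c else 0) = g"
  unfolding val_def by (rule Least_equality) (use assms in \<open>auto simp: supp_def split: if_splits\<close>)

text \<open>
  A comparison of values says which initial segments of \<open>G\<close> a series avoids. Phrasing this for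
  every downward closed set covers both \<open>v \<ge> 0\<close> and \<open>v > 0\<close>, and includes the zero series.
\<close>
lemma vanishing_transfer:
  assumes "well_ordered (supp a)" "well_ordered (supp b)"
    and "a = (\<lambda>_. 0) \<Longrightarrow> b = (\<lambda>_. 0)"
    and "a \<noteq> (\<lambda>_. 0) \<Longrightarrow> val b = val a"
    and "\<And>h h'. h \<in> H \<Longrightarrow> h' \<le> h \<Longrightarrow> h' \<in> H"
    and "\<And>h. h \<in> H \<Longrightarrow> a h = 0"
    and "h \<in> H"
  shows "b h = 0"
proof (cases "a = (\<lambda>_. 0)")
  case True
  then show ?thesis using assms(3) by simp
next
  case False
  show ?thesis
  proof (rule ccontr)
    assume nz: "b h \<noteq> 0"
    then have "b \<noteq> (\<lambda>_. 0)" by auto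
    then have "val a \<le> h" using val_le[OF assms(2) _ nz] assms(4)[OF False] by simp
    then have "a (val a) = 0" using assms(5-7) by blast
    then show False using val_in_supp[OF assms(1) False] by simp
  qed
qed

section \<open>Internal automorphisms form a group\<close>

locale monomial_subring =
  fixes K :: "('g::linordered_ab_group_add \<Rightarrow> 'k::field) set"
  assumes wo: "a \<in> K \<Longrightarrow> well_ordered (supp a)"
    and monomial: "(\<lambda>h. if h = g then c else 0) \<in> K"
    and diff: "a \<in> K \<Longrightarrow> b \<in> K \<Longrightarrow> (\<lambda>g. a g - b g) \<in> K"
    and mult: "a \<in> K \<Longrightarrow> b \<in> K \<Longrightarrow> hahn_mult a b \<in> K"
begin

lemma zero: "(\<lambda>_. 0) \<in> K"
  using monomial[of _ 0] by simp

lemma const: "const c \<in> K"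
  unfolding const_def by (rule monomial)

lemma add: "a \<in> K \<Longrightarrow> b \<in> K \<Longrightarrow> (\<lambda>g. a g + b g) \<in> K"
  using diff[of a "\<lambda>g. 0 - b g"] diff[OF zero, of b] by simp

lemma field_aut_iff:
  "\<sigma> \<in> field_aut K \<longleftrightarrow> \<sigma> \<in> Bij K \<and>
     (\<forall>a\<in>K. \<forall>b\<in>K. \<sigma> (hahn_mult a b) = hahn_mult (\<sigma> a) (\<sigma> b)) \<and>
     (\<forall>a\<in>K. \<forall>b\<in>K. \<sigma> (\<lambda>g. a g + b g) = (\<lambda>g. \<sigma> a g + \<sigma> b g)) \<and>
     \<sigma> (Defs.const 1) = Defs.const 1"
  unfolding field_aut_def ring_iso_def ring_hom_def Bij_def hahn_ring_def bij_betw_def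
  by auto

lemma field_aut_bij: "\<sigma> \<in> field_aut K \<Longrightarrow> \<sigma> \<in> Bij K"
  by (simp add: field_aut_iff)

lemma field_aut_closed: "\<sigma> \<in> field_aut K \<Longrightarrow> a \<in> K \<Longrightarrow> \<sigma> a \<in> K"
  using field_aut_bij[of \<sigma>] by (auto simp: Bij_def bij_betw_def)

lemma field_aut_add:
  "\<sigma> \<in> field_aut K \<Longrightarrow> a \<in> K \<Longrightarrow> b \<in> K \<Longrightarrow> \<sigma> (\<lambda>g. a g + b g) = (\<lambda>g. \<sigma> a g + \<sigma> b g)"
  by (simp add: field_aut_iff)

lemma field_aut_zero:
  assumes "\<sigma> \<in> field_aut K"
  shows "\<sigma> (\<lambda>_. 0) = (\<lambda>_. 0)"
proof -
  have "\<sigma> (\<lambda>_. 0 + 0) = (\<lambda>g. \<sigma> (\<lambda>_. 0) g + \<sigma> (\<lambda>_. 0) g)"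
    using assms zero zero by (rule field_aut_add)
  then have "\<sigma> (\<lambda>_. 0) g + 0 = \<sigma> (\<lambda>_. 0) g + \<sigma> (\<lambda>_. 0) g" for g
    unfolding add_0_right by (rule fun_cong)
  then have "\<sigma> (\<lambda>_. 0) g = 0" for g by (metis add_left_cancel)
  then show ?thesis by (rule ext)
qed

lemma field_aut_nonzero:
  assumes "\<sigma> \<in> field_aut K" "a \<in> K" "a \<noteq> (\<lambda>_. 0)"
  shows "\<sigma> a \<noteq> (\<lambda>_. 0)"
  using field_aut_bij[OF assms(1)] field_aut_zero[OF assms(1)] zero assms(2,3)
  by (metis Bij_def IntD2 bij_betw_def inj_onD mem_Collect_eq)

text \<open>
  The description of internal automorphisms with which all proofs work: the values of monomials
  exhaust \<open>G\<close>, so inducing the identity on \<open>G\<close> means precisely that values are preserved.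
\<close>
definition internal :: "(('g \<Rightarrow> 'k) \<Rightarrow> ('g \<Rightarrow> 'k)) \<Rightarrow> bool" where
  "internal \<sigma> \<longleftrightarrow> \<sigma> \<in> field_aut K \<and> (\<forall>a\<in>K. a \<noteq> (\<lambda>_. 0) \<longrightarrow> val (\<sigma> a) = val a) \<and>
     (\<forall>c. \<sigma> (Defs.const c) 0 = c)"

lemma induces_unique:
  assumes "induces K \<sigma> \<tau>" "induces K \<sigma> \<tau>'"
  shows "\<tau> = \<tau>'"
proof
  fix g
  let ?m = "\<lambda>h::'g. if h = g then 1 else (0::'k)"
  have "?m g \<noteq> 0" by simp
  then have "?m \<noteq> (\<lambda>_. 0)" by metis
  then have "?m \<in> K - {\<zero>\<^bsub>hahn_ring\<^esub>}"
    using monomial[of g 1] by (simp add: hahn_ring_def)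
  then have "\<tau> (val ?m) = \<tau>' (val ?m)"
    using assms unfolding induces_def by metis
  then show "\<tau> g = \<tau>' g" by (simp add: val_monomial)
qed

lemma induces_id_iff: "induces K \<sigma> id \<longleftrightarrow> (\<forall>a\<in>K. a \<noteq> (\<lambda>_. 0) \<longrightarrow> val (\<sigma> a) = val a)"
proof -
  have "id \<in> iso add_group add_group"
    by (auto simp: iso_def hom_def)
  moreover have "mono (id :: 'g \<Rightarrow> 'g)" by (simp add: mono_def)
  ultimately show ?thesis by (auto simp: induces_def hahn_ring_def)
qed

lemma carrier_IntAut: "carrier (IntAut K) = {\<sigma>. internal \<sigma>}"
proof -
  have "(\<exists>\<tau>. induces K \<sigma> \<tau>) \<and> induced_G K \<sigma> = id \<longleftrightarrow> induces K \<sigma> id" for \<sigma>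
    unfolding induced_G_def by (metis (mono_tags, lifting) induces_unique the_equality)
  then have "\<sigma> \<in> v_aut K \<and> induced_G K \<sigma> = id \<longleftrightarrow> \<sigma> \<in> field_aut K \<and> induces K \<sigma> id" for \<sigma>
    unfolding v_aut_def by blast
  then show ?thesis
    unfolding IntAut_def internal_def induces_id_iff[symmetric] induced_k_def
    by (auto simp: fun_eq_iff)
qed

lemma internal_vanishing:
  assumes "internal \<sigma>" "a \<in> K"
    and "\<And>h h'. h \<in> H \<Longrightarrow> h' \<le> h \<Longrightarrow> h' \<in> H"
    and "\<And>h. h \<in> H \<Longrightarrow> a h = 0"
    and "h \<in> H"
  shows "\<sigma> a h = 0"
  using vanishing_transfer[of a "\<sigma> a" H h] assms field_aut_zero[of \<sigma>] field_aut_closed[of \<sigma> a] wo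
  unfolding internal_def by metis

text \<open>
  Split \<open>a = c + r\<close> with \<open>c\<close> its constant term, so that \<open>v r > 0\<close>. Then \<open>\<sigma> r\<close> has no constant term
  either, and \<open>\<sigma> c\<close> has constant term \<open>c\<close>.
\<close>
lemma internal_residue:
  assumes "internal \<sigma>" "a \<in> K" "\<And>h. h < 0 \<Longrightarrow> a h = 0"
  shows "\<sigma> a 0 = a 0"
proof -
  let ?c = "Defs.const (a 0)" and ?r = "\<lambda>g. a g - Defs.const (a 0) g"
  have r: "?r \<in> K" using diff[OF assms(2) const] .
  have "\<sigma> (\<lambda>g. ?r g + ?c g) = (\<lambda>g. \<sigma> ?r g + \<sigma> ?c g)"
    using assms(1) r const unfolding internal_def by (intro field_aut_add) blast+
  then have "\<sigma> a 0 = \<sigma> ?r 0 + \<sigma> ?c 0" by (simp add: fun_eq_iff)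
  moreover have "\<sigma> ?r 0 = 0"
    by (rule internal_vanishing[OF assms(1) r, where H = "{..0}"])
      (use assms(3) in \<open>auto simp: const_def\<close>)
  moreover have "\<sigma> ?c 0 = a 0" using assms(1) by (simp add: internal_def)
  ultimately show ?thesis by simp
qed

lemma internal_compose:
  assumes "internal \<sigma>" "internal \<tau>"
  shows "internal (compose K \<sigma> \<tau>)"
proof -
  note s = assms(1)[unfolded internal_def] and t = assms(2)[unfolded internal_def]
  have tK: "\<tau> a \<in> K" if "a \<in> K" for a using field_aut_closed t that by blast
  have "compose K \<sigma> \<tau> \<in> field_aut K"
    using s t tK mult add const compose_Bij[of \<sigma> K \<tau>] unfolding field_aut_iff
    by (simp add: compose_eq)
  moreover have "val (compose K \<sigma> \<tau> a) = val a" if "a \<in> K" "a \<noteq> (\<lambda>_. 0)" for a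
    using s t tK that field_aut_nonzero[of \<tau> a] by (simp add: compose_eq)
  moreover have "compose K \<sigma> \<tau> (Defs.const c) 0 = c" for c
  proof -
    have "\<tau> (Defs.const c) h = 0" if "h < 0" for h
      by (rule internal_vanishing[OF assms(2) const, where H = "{..<0}"])
        (use that in \<open>auto simp: const_def\<close>)
    then have "\<sigma> (\<tau> (Defs.const c)) 0 = \<tau> (Defs.const c) 0"
      using internal_residue[OF assms(1) tK[OF const]] by blast
    then show ?thesis using t const by (simp add: compose_eq)
  qed
  ultimately show ?thesis unfolding internal_def by blast
qed

lemma internal_inverse:
  assumes "internal \<sigma>"
  shows "internal (\<lambda>a\<in>K. inv_into K \<sigma> a)"
proof -
  note s = assms[unfolded internal_def]
  let ?i = "\<lambda>a\<in>K. inv_into K \<sigma> a"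
  have bij: "\<sigma> \<in> Bij K" using s field_aut_bij by blast
  then have inj: "inj_on \<sigma> K" and img: "\<sigma> ` K = K" by (auto simp: Bij_def bij_betw_def)
  have iK: "?i a \<in> K" and si: "\<sigma> (?i a) = a" if "a \<in> K" for a
    using that img by (simp_all add: inv_into_into f_inv_into_f)
  have inv_eq: "?i a = b" if "b \<in> K" "\<sigma> b = a" for a b
    using that inj field_aut_closed s by auto
  have aut: "?i \<in> field_aut K"
    unfolding field_aut_iff
  proof (intro conjI ballI)
    show "?i \<in> Bij K" using bij by (rule restrict_inv_into_Bij)
  next
    fix a b assume ab: "a \<in> K" "b \<in> K"
    show "?i (hahn_mult a b) = hahn_mult (?i a) (?i b)"
      using s si iK mult ab by (intro inv_eq) (simp_all add: field_aut_iff del: restrict_apply)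
    show "?i (\<lambda>g. a g + b g) = (\<lambda>g. ?i a g + ?i b g)"
      using s si iK add ab by (intro inv_eq) (simp_all add: field_aut_iff del: restrict_apply)
  next
    show "?i (Defs.const 1) = Defs.const 1"
      using s const by (intro inv_eq) (simp_all add: field_aut_iff)
  qed
  have v: "val (?i a) = val a" if "a \<in> K" "a \<noteq> (\<lambda>_. 0)" for a
  proof -
    have "?i a \<noteq> (\<lambda>_. 0)" using aut that by (rule field_aut_nonzero)
    then have "val (\<sigma> (?i a)) = val (?i a)" using s iK[OF that(1)] by blast
    then show ?thesis using si[OF that(1)] by simp
  qed
  have "?i (Defs.const c) 0 = c" for c
  proof -
    let ?b = "?i (Defs.const c)"
    have b: "?b \<in> K" "\<sigma> ?b = Defs.const c" using iK[OF const] si[OF const] .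
    have "?b h = 0" if "h < 0" for h
      by (rule vanishing_transfer[where a = "Defs.const c" and H = "{..<0}"])
        (use that v[OF const] wo[OF const] wo[OF b(1)] field_aut_zero[OF aut] in
          \<open>auto simp: const_def simp del: restrict_apply\<close>)
    then have "\<sigma> ?b 0 = ?b 0" by (rule internal_residue[OF assms b(1)])
    with b(2) show ?thesis by (simp add: const_def del: restrict_apply)
  qed
  with aut v show ?thesis unfolding internal_def by blast
qed

lemma group_IntAut: "group (IntAut K)"
proof -
  have sub: "internal \<sigma> \<Longrightarrow> \<sigma> \<in> Bij K" for \<sigma>
    by (simp add: internal_def field_aut_bij)
  have id: "internal (\<lambda>a\<in>K. a)"
    unfolding internal_def field_aut_iff
    using mult add const id_Bij[of K] by (auto simp: const_def)
  have "subgroup {\<sigma>. internal \<sigma>} (BijGroup K)"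
  proof (rule group.subgroupI[OF group_BijGroup])
    show "{\<sigma>. internal \<sigma>} \<subseteq> carrier (BijGroup K)"
      using sub by (auto simp: BijGroup_def)
    show "{\<sigma>. internal \<sigma>} \<noteq> {}" using id by blast
    show "inv\<^bsub>BijGroup K\<^esub> \<sigma> \<in> {\<sigma>. internal \<sigma>}" if "\<sigma> \<in> {\<sigma>. internal \<sigma>}" for \<sigma>
      using that sub internal_inverse by (simp add: inv_BijGroup)
    show "\<sigma> \<otimes>\<^bsub>BijGroup K\<^esub> \<tau> \<in> {\<sigma>. internal \<sigma>}"
      if "\<sigma> \<in> {\<sigma>. internal \<sigma>}" "\<tau> \<in> {\<sigma>. internal \<sigma>}" for \<sigma> \<tau>
      using that sub internal_compose by (simp add: BijGroup_def)
  qed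
  then have "group (BijGroup K\<lparr>carrier := {\<sigma>. internal \<sigma>}\<rparr>)"
    by (rule subgroup.subgroup_is_group[OF _ group_BijGroup])
  moreover have "IntAut K = BijGroup K\<lparr>carrier := {\<sigma>. internal \<sigma>}\<rparr>"
    using carrier_IntAut by (simp add: IntAut_def)
  ultimately show ?thesis by simp
qed

lemma mult_IntAut:
  assumes "internal \<sigma>" "internal \<tau>"
  shows "\<sigma> \<otimes>\<^bsub>IntAut K\<^esub> \<tau> = compose K \<sigma> \<tau>"
  using assms by (simp add: IntAut_def BijGroup_def internal_def field_aut_bij)

end

section \<open>Rayner fields are rings containing all monomials\<close>

lemma field_family_singleton:
  fixes \<F> :: "'g::linordered_ab_group_add set set"
  assumes nontriv: "\<exists>g::'g. g \<noteq> 0" and F: "field_family \<F>"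
  shows "{g} \<in> \<F>"
proof -
  have sub: "\<And>A B. A \<in> \<F> \<Longrightarrow> B \<subseteq> A \<Longrightarrow> B \<in> \<F>"
    and shift: "\<And>A g. A \<in> \<F> \<Longrightarrow> (\<lambda>a. a + g) ` A \<in> \<F>"
    and gen: "generate add_group (\<Union>\<F>) = UNIV"
    using F unfolding field_family_def by blast+
  (* The empty set generates the trivial group only, so some member of the family is nonempty. *)
  have "\<Union>\<F> \<noteq> {}"
  proof
    assume "\<Union>\<F> = {}"
    with gen have gen0: "generate add_group {} = (UNIV :: 'g set)" by metis
    have "h = 0" if "h \<in> generate add_group {}" for h :: 'g
      using that by (induction rule: generate.induct) (simp_all add: add_group_def)
    then show False using gen0 nontriv by blast
  qed
  then obtain A x where "A \<in> \<F>" "x \<in> A" by blast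
  then have "(\<lambda>a. a + (g - x)) ` {x} \<in> \<F>" using sub shift by blast
  then show ?thesis by simp
qed

text \<open>
  Closure under finite sums is available for subsets of the nonnegative cone only. Both sets are
  therefore translated so that their least elements become \<open>0\<close>; sums of two elements are then
  among the finite sums of elements of the union, and can be translated back.
\<close>
lemma field_family_sumset:
  fixes \<F> :: "'g::linordered_ab_group_add set set"
  assumes F: "field_family \<F>" and AB: "A \<in> \<F>" "B \<in> \<F>"
  shows "{a + b | a b. a \<in> A \<and> b \<in> B} \<in> \<F>"
proof (cases "A = {} \<or> B = {}")
  case True
  then show ?thesis
    using F AB unfolding field_family_def by auto
next
  case False
  have wo: "\<And>A. A \<in> \<F> \<Longrightarrow> well_ordered A"
    and un: "\<And>A B. A \<in> \<F> \<Longrightarrow> B \<in> \<F> \<Longrightarrow> A \<union> B \<in> \<F>"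
    and sub: "\<And>A B. A \<in> \<F> \<Longrightarrow> B \<subseteq> A \<Longrightarrow> B \<in> \<F>"
    and shift: "\<And>A g. A \<in> \<F> \<Longrightarrow> (\<lambda>a. a + g) ` A \<in> \<F>"
    and sums: "\<And>A. A \<in> \<F> \<Longrightarrow> A \<subseteq> {0..} \<Longrightarrow> {sum_list xs | xs. set xs \<subseteq> A} \<in> \<F>"
    using F unfolding field_family_def by blast+
  obtain m n where m: "\<And>x. x \<in> A \<Longrightarrow> m \<le> x" and n: "\<And>x. x \<in> B \<Longrightarrow> n \<le> x"
    using well_ordered_has_least[OF wo[OF AB(1)]] well_ordered_has_least[OF wo[OF AB(2)]] False
    by metis
  let ?C = "(\<lambda>a. a + (- m)) ` A \<union> (\<lambda>b. b + (- n)) ` B"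
  let ?S = "{sum_list xs | xs. set xs \<subseteq> ?C}"
  have "?C \<subseteq> {0..}" using m n by auto
  then have "?S \<in> \<F>" by (rule sums[OF un[OF shift shift], OF AB])
  then have "(\<lambda>a. a + (m + n)) ` ?S \<in> \<F>" by (rule shift)
  moreover have "{a + b | a b. a \<in> A \<and> b \<in> B} \<subseteq> (\<lambda>a. a + (m + n)) ` ?S"
  proof
    fix z assume "z \<in> {a + b | a b. a \<in> A \<and> b \<in> B}"
    then obtain a b where z: "z = a + b" "a \<in> A" "b \<in> B" by blast
    have "set [a + (- m), b + (- n)] \<subseteq> ?C" using z by auto
    then have "sum_list [a + (- m), b + (- n)] \<in> ?S" by blast
    moreover have "z = sum_list [a + (- m), b + (- n)] + (m + n)"
      using z by (simp add: algebra_simps)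
    ultimately show "z \<in> (\<lambda>a. a + (m + n)) ` ?S" by blast
  qed
  ultimately show ?thesis using sub by blast
qed

lemma supp_hahn_mult: "supp (hahn_mult a b) \<subseteq> {h + h' | h h'. h \<in> supp a \<and> h' \<in> supp b}"
proof
  fix g assume "g \<in> supp (hahn_mult a b)"
  then have "(\<Sum>h | h \<in> supp a \<and> g - h \<in> supp b. a h * b (g - h)) \<noteq> 0"
    by (simp add: supp_def hahn_mult_def)
  then obtain h where "h \<in> supp a" "g - h \<in> supp b"
    by (auto elim: sum.not_neutral_contains_not_neutral)
  moreover have "g = h + (g - h)" by simp
  ultimately show "g \<in> {h + h' | h h'. h \<in> supp a \<and> h' \<in> supp b}" by blast
qed

lemma in_rayner_set_iff: "field_family \<F> \<Longrightarrow> a \<in> rayner_set \<F> \<longleftrightarrow> supp a \<in> \<F>"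
  by (auto simp: rayner_set_def hahn_ring_def field_family_def)

lemma rayner_monomial_subring:
  fixes \<F> :: "'g::linordered_ab_group_add set set"
  assumes nontriv: "\<exists>g::'g. g \<noteq> 0" and F: "field_family \<F>"
  shows "monomial_subring (rayner_set \<F> :: ('g \<Rightarrow> 'k::field) set)"
proof
  note iff = in_rayner_set_iff[OF F]
  have un: "\<And>A B. A \<in> \<F> \<Longrightarrow> B \<in> \<F> \<Longrightarrow> A \<union> B \<in> \<F>"
    and sub: "\<And>A B. A \<in> \<F> \<Longrightarrow> B \<subseteq> A \<Longrightarrow> B \<in> \<F>"
    using F unfolding field_family_def by blast+
  fix a b :: "'g \<Rightarrow> 'k" and g :: 'g and c :: 'k
  show "well_ordered (supp a)" if "a \<in> rayner_set \<F>"
    using that by (simp add: rayner_set_def hahn_ring_def)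
  have "supp (\<lambda>h. if h = g then c else 0) \<subseteq> {g}" by (auto simp: supp_def)
  then show "(\<lambda>h. if h = g then c else 0) \<in> rayner_set \<F>"
    using sub[OF field_family_singleton[OF nontriv F]] iff by blast
  have "supp (\<lambda>g. a g - b g) \<subseteq> supp a \<union> supp b" by (auto simp: supp_def)
  then show "(\<lambda>g. a g - b g) \<in> rayner_set \<F>" if "a \<in> rayner_set \<F>" "b \<in> rayner_set \<F>"
    using that sub un iff by blast
  show "hahn_mult a b \<in> rayner_set \<F>" if "a \<in> rayner_set \<F>" "b \<in> rayner_set \<F>"
    using that sub[OF field_family_sumset[OF F] supp_hahn_mult] iff by blast
qed

section \<open>Characters and the lifting\<close>

lemma in_char_group_iff:
  "x \<in> carrier char_group \<longleftrightarrow> (\<forall>g. x g \<noteq> 0) \<and> (\<forall>g h. x (g + h) = x g * x h)"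
  by (auto simp: char_group_def hom_def add_group_def units_group_def)

lemma char_zero: "x \<in> carrier char_group \<Longrightarrow> x 0 = 1"
  unfolding in_char_group_iff by (metis add_0 mult_cancel_right1)

lemma mult_char_group: "x \<otimes>\<^bsub>char_group\<^esub> y = (\<lambda>g. x g * y g)"
  by (simp add: char_group_def)

lemma char_inverse_closed:
  "x \<in> carrier char_group \<Longrightarrow> (\<lambda>g. inverse (x g)) \<in> carrier char_group"
  by (simp add: in_char_group_iff)

lemma group_char_group: "group char_group"
proof (rule groupI)
  fix x :: "'g::linordered_ab_group_add \<Rightarrow> 'k::field"
  assume x: "x \<in> carrier char_group"
  have "(\<lambda>g. inverse (x g)) \<otimes>\<^bsub>char_group\<^esub> x = \<one>\<^bsub>char_group\<^esub>"
    using x by (simp add: mult_char_group in_char_group_iff) (simp add: char_group_def)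
  then show "\<exists>y\<in>carrier char_group. y \<otimes>\<^bsub>char_group\<^esub> x = \<one>\<^bsub>char_group\<^esub>"
    using char_inverse_closed[OF x] by blast
qed (simp_all add: in_char_group_iff mult_char_group mult_ac, simp_all add: char_group_def)

lemma supp_char_mult:
  "x \<in> carrier char_group \<Longrightarrow> supp (\<lambda>g. a g * x g) = supp a"
  by (simp add: supp_def in_char_group_iff)

lemma hahn_mult_char_mult:
  assumes x: "x \<in> carrier char_group"
  shows "hahn_mult (\<lambda>g. a g * x g) (\<lambda>g. b g * x g) = (\<lambda>g. hahn_mult a b g * x g)"
proof
  fix g
  have "(a h * x h) * (b (g - h) * x (g - h)) = a h * b (g - h) * x g" for h
  proof -
    have "x (h + (g - h)) = x h * x (g - h)" using x unfolding in_char_group_iff by blast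
    then show ?thesis by (simp add: mult_ac)
  qed
  then show "hahn_mult (\<lambda>g. a g * x g) (\<lambda>g. b g * x g) g = hahn_mult a b g * x g"
    unfolding hahn_mult_def supp_char_mult[OF x] sum_distrib_right by (intro sum.cong refl)
qed

text \<open>
  The hypothesis on \<open>K\<close> is the property that Rayner fields have by definition: membership of a
  series is decided by its support.
\<close>
lemma (in monomial_subring) rho_internal:
  assumes supp_closed: "\<And>a b. a \<in> K \<Longrightarrow> supp b = supp a \<Longrightarrow> b \<in> K"
    and x: "x \<in> carrier char_group"
  shows "internal (rho K x)"
proof -
  have closed: "(\<lambda>g. a g * y g) \<in> K" if "a \<in> K" "y \<in> carrier char_group" for a y
    using that supp_closed supp_char_mult by blast
  have nz: "x g \<noteq> 0" for g using x by (simp add: in_char_group_iff)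
  have "bij_betw (rho K x) K K"
    by (rule bij_betw_byWitness[where f' = "rho K (\<lambda>g. inverse (x g))"])
      (use closed[OF _ x] closed[OF _ char_inverse_closed[OF x]] nz in
        \<open>auto simp: rho_def mult.assoc\<close>)
  then have "rho K x \<in> Bij K" by (simp add: Bij_def rho_def)
  moreover have "(\<lambda>g. Defs.const c g * x g) = Defs.const c" for c
    using char_zero[OF x] by (auto simp: const_def)
  ultimately have "rho K x \<in> field_aut K" and "rho K x (Defs.const c) 0 = c" for c
    using mult add const
    by (auto simp: field_aut_iff rho_def hahn_mult_char_mult[OF x] distrib_right) (simp add: const_def)
  moreover have "val (rho K x a) = val a" if "a \<in> K" for a
    using that by (simp add: rho_def val_def supp_char_mult[OF x])
  ultimately show ?thesis unfolding internal_def by blast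
qed

theorem lemma3p6p5:
  fixes K :: "('g::linordered_ab_group_add \<Rightarrow> 'k::field) set"
  assumes "\<exists>g::'g. g \<noteq> 0"
    and "rayner_field K"
  shows "canonical_second_lifting K"
proof -
  obtain \<F> where F: "field_family \<F>" and K: "K = rayner_set \<F>"
    using assms(2) unfolding rayner_field_def by blast
  interpret monomial_subring K
    unfolding K by (rule rayner_monomial_subring[OF assms(1) F])
  have supp_closed: "b \<in> K" if "a \<in> K" "supp b = supp a" for a b
    using that unfolding K in_rayner_set_iff[OF F] by simp
  note rho = rho_internal[OF supp_closed]
  have "rho K \<in> hom char_group (IntAut K)"
  proof (rule homI)
    fix x assume "x \<in> carrier (char_group :: ('g \<Rightarrow> 'k) monoid)"
    then show "rho K x \<in> carrier (IntAut K)" using rho by (simp add: carrier_IntAut)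
  next
    fix x y assume x: "x \<in> carrier (char_group :: ('g \<Rightarrow> 'k) monoid)"
      and y: "y \<in> carrier (char_group :: ('g \<Rightarrow> 'k) monoid)"
    have "(\<lambda>g. a g * y g) \<in> K" if "a \<in> K" for a
      using that supp_closed supp_char_mult[OF y] by blast
    then have "rho K (x \<otimes>\<^bsub>char_group\<^esub> y) = compose K (rho K x) (rho K y)"
      by (auto simp: rho_def compose_def mult_char_group mult_ac)
    then show "rho K (x \<otimes>\<^bsub>char_group\<^esub> y) = rho K x \<otimes>\<^bsub>IntAut K\<^esub> rho K y"
      using mult_IntAut[OF rho[OF _ _ x] rho[OF _ _ y]] by simp
  qed
  then show ?thesis
    unfolding canonical_second_lifting_def
    by (intro group_hom.intro group_hom_axioms.intro group_char_group group_IntAut)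
qed

end
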